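(* Let $(R,M)$ be a commutative Noetherian local ring and let $N$ be a finitely generated $R$-module. Then $N$ is Cohen--Macaulay if and only if $N$ is initially Cohen--Macaulay and counmixed.
   Context: For a prime ideal $P$ of $R$, the coheight is $\mathrm{coht}\,P=\dim R/P$. The initial dimension of an $R$-module $N$ is $\mathrm{indim}\,N=\inf\{\mathrm{coht}\,P\mid P\in\mathrm{Ass}_R N\}$. A finitely generated $R$-module $N$ over a local ring is initially Cohen--Macaulay if $N=0$ or $\mathrm{depth}\,N=\mathrm{indim}\,N$. An $R$-module $N$ is counmixed if all its associated primes have the same coheight. *)

theory Defs
  imports
    "HOL-Algebra.QuotRing"
    "HOL-Algebra.Ring_Divisibility"
    "HOL-Algebra.Module"
    "HOL-Library.Extended_Nat"
begin

locale local_ring = cring R + maximalideal M R for M and R (structure) +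
  assumes maximal_unique: "maximalideal J R \<Longrightarrow> J = M"

text \<open>Supremum of the lengths \<open>n\<close> of chains \<open>Q 0 \<subset> \<dots> \<subset> Q n\<close> of prime ideals. Only quotients by
  proper ideals matter below; the zero ring gets the value \<open>0\<close> as \<open>enat\<close> has no \<open>- \<infinity>\<close>.\<close>

definition krull_dim :: "('a, 'r) ring_scheme \<Rightarrow> enat" where
  "krull_dim A = Sup {enat n | n. \<exists>Q :: nat \<Rightarrow> 'a set.
     (\<forall>i\<le>n. primeideal (Q i) A) \<and> (\<forall>i<n. Q i \<subset> Q (Suc i))}"

definition coheight :: "('a, 'r) ring_scheme \<Rightarrow> 'a set \<Rightarrow> enat" where
  "coheight R P = krull_dim (R Quot P)"

definition generated_submodule ::
    "('a, 'r) ring_scheme \<Rightarrow> ('a, 'b, 'm) module_scheme \<Rightarrow> 'b set \<Rightarrow> 'b set" where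
  "generated_submodule R N S = \<Inter>{H. submodule H R N \<and> S \<subseteq> H}"

definition finitely_generated_module ::
    "('a, 'r) ring_scheme \<Rightarrow> ('a, 'b, 'm) module_scheme \<Rightarrow> bool" where
  "finitely_generated_module R N \<longleftrightarrow>
     (\<exists>S. finite S \<and> S \<subseteq> carrier N \<and> generated_submodule R N S = carrier N)"

definition element_annihilator ::
    "('a, 'r) ring_scheme \<Rightarrow> ('a, 'b, 'm) module_scheme \<Rightarrow> 'b \<Rightarrow> 'a set" where
  "element_annihilator R N x = {a \<in> carrier R. a \<odot>\<^bsub>N\<^esub> x = \<zero>\<^bsub>N\<^esub>}"

definition module_annihilator ::
    "('a, 'r) ring_scheme \<Rightarrow> ('a, 'b, 'm) module_scheme \<Rightarrow> 'a set" where
  "module_annihilator R N = {a \<in> carrier R. \<forall>x \<in> carrier N. a \<odot>\<^bsub>N\<^esub> x = \<zero>\<^bsub>N\<^esub>}"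

definition associated_primes ::
    "('a, 'r) ring_scheme \<Rightarrow> ('a, 'b, 'm) module_scheme \<Rightarrow> 'a set set" where
  "associated_primes R N =
     {P. primeideal P R \<and> (\<exists>x \<in> carrier N. P = element_annihilator R N x)}"

definition module_dim :: "('a, 'r) ring_scheme \<Rightarrow> ('a, 'b, 'm) module_scheme \<Rightarrow> enat" where
  "module_dim R N = krull_dim (R Quot module_annihilator R N)"

text \<open>The infimum of the empty set is \<open>\<infinity>\<close> in \<open>enat\<close>.\<close>

definition indim :: "('a, 'r) ring_scheme \<Rightarrow> ('a, 'b, 'm) module_scheme \<Rightarrow> enat" where
  "indim R N = Inf (coheight R ` associated_primes R N)"

text \<open>For a set \<open>X\<close> of scalars, the submodule \<open>(X)N\<close>.\<close>

definition scalar_submodule ::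
    "('a, 'r) ring_scheme \<Rightarrow> ('a, 'b, 'm) module_scheme \<Rightarrow> 'a set \<Rightarrow> 'b set" where
  "scalar_submodule R N X = generated_submodule R N {a \<odot>\<^bsub>N\<^esub> y | a y. a \<in> X \<and> y \<in> carrier N}"

text \<open>That \<open>xs ! i\<close> is a nonzerodivisor on \<open>N/(xs ! 0, \<dots>, xs ! (i - 1))N\<close> is written out on
  representatives.\<close>

definition regular_sequence ::
    "('a, 'r) ring_scheme \<Rightarrow> ('a, 'b, 'm) module_scheme \<Rightarrow> 'a list \<Rightarrow> bool" where
  "regular_sequence R N xs \<longleftrightarrow>
     set xs \<subseteq> carrier R \<and>
     (\<forall>i < length xs. \<forall>y \<in> carrier N.
        (xs ! i) \<odot>\<^bsub>N\<^esub> y \<in> scalar_submodule R N (set (take i xs)) \<longrightarrow>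
        y \<in> scalar_submodule R N (set (take i xs))) \<and>
     scalar_submodule R N (set xs) \<noteq> carrier N"

text \<open>\<open>M\<close> is meant to be the maximal ideal of the local ring \<open>R\<close>.\<close>

definition depth ::
    "('a, 'r) ring_scheme \<Rightarrow> 'a set \<Rightarrow> ('a, 'b, 'm) module_scheme \<Rightarrow> enat" where
  "depth R M N = Sup {enat (length xs) | xs. regular_sequence R N xs \<and> set xs \<subseteq> M}"

definition cohen_macaulay ::
    "('a, 'r) ring_scheme \<Rightarrow> 'a set \<Rightarrow> ('a, 'b, 'm) module_scheme \<Rightarrow> bool" where
  "cohen_macaulay R M N \<longleftrightarrow> carrier N = {\<zero>\<^bsub>N\<^esub>} \<or> depth R M N = module_dim R N"

definition initially_cohen_macaulay ::
    "('a, 'r) ring_scheme \<Rightarrow> 'a set \<Rightarrow> ('a, 'b, 'm) module_scheme \<Rightarrow> bool" where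
  "initially_cohen_macaulay R M N \<longleftrightarrow> carrier N = {\<zero>\<^bsub>N\<^esub>} \<or> depth R M N = indim R N"

definition counmixed :: "('a, 'r) ring_scheme \<Rightarrow> ('a, 'b, 'm) module_scheme \<Rightarrow> bool" where
  "counmixed R N \<longleftrightarrow>
     (\<forall>P \<in> associated_primes R N. \<forall>Q \<in> associated_primes R N. coheight R P = coheight R Q)"

end

theory Submission
  imports Defs
begin

text \<open>If \<open>P\<close> is associated to \<open>N/K\<close> and \<open>x \<in> M\<close> is a nonzerodivisor on \<open>N/K\<close>, then some prime
  associated to \<open>N/(K + xN)\<close> strictly contains \<open>P\<close>. Following a regular sequence, each associated
  prime of \<open>N\<close> starts a chain of primes as long as the sequence, so \<open>depth N \<le> coht P\<close>. Since
  every prime over the annihilator contains an associated prime, \<open>dim N\<close> is the supremum of these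
  coheights, and \<open>depth N \<le> indim N \<le> dim N\<close> with equality on the right exactly when all the
  coheights agree. Quotient modules are avoided: an element of
  \<open>N/K\<close> is a representative in \<open>N\<close>, its annihilator the colon ideal \<open>(K : x)\<close>.\<close>

section \<open>Prime ideals of quotient rings\<close>

text \<open>Two elements of one coset of \<open>I\<close> differ by an element of \<open>I\<close>,
  and \<open>I\<close> lies in \<open>P\<close>, so a coset meeting \<open>P\<close> lies in
  \<open>P\<close>.\<close>

lemma (in ring) rcos_mem_image_iff:
  assumes I: "ideal I R" and P: "ideal P R" and "I \<subseteq> P" and a: "a \<in> carrier R"
  shows "I +> a \<in> (+>) I ` P \<longleftrightarrow> a \<in> P"
proof
  assume "I +> a \<in> (+>) I ` P"
  then obtain p where p: "p \<in> P" "I +> a = I +> p" by blast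
  then have pc: "p \<in> carrier R" using ideal.Icarr[OF P] by blast
  with p a have "a \<ominus> p \<in> P"
    using quotient_eq_iff_same_a_r_cos[OF I] \<open>I \<subseteq> P\<close> by blast
  then have "(a \<ominus> p) \<oplus> p \<in> P"
    using p(1) additive_subgroup.a_closed[OF ideal.axioms(1)[OF P]] by blast
  moreover have "(a \<ominus> p) \<oplus> p = a" using a pc by algebra
  ultimately show "a \<in> P" by simp
qed simp

lemma (in ring) carrier_quotient: "carrier (R Quot I) = (+>) I ` carrier R"
  by (auto simp: FactRing_def A_RCOSETS_def')

lemma (in ideal) rcos_mult:
  assumes "a \<in> carrier R" "b \<in> carrier R"
  shows "(I +> a) \<otimes>\<^bsub>R Quot I\<^esub> (I +> b) = I +> (a \<otimes> b)"
  using assms by (simp add: FactRing_def rcoset_mult_add)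

text \<open>One half of the correspondence theorem: with \<open>I\<close> inside \<open>P\<close>,
  membership in the image can be tested on representatives, so primality carries over from
  \<open>P\<close>.\<close>

lemma (in cring) primeideal_quotient_image:
  assumes I: "ideal I R" and P: "primeideal P R" and IP: "I \<subseteq> P"
  shows "primeideal ((+>) I ` P) (R Quot I)"
proof (rule primeidealI)
  have Pi: "ideal P R" using P by (simp add: primeideal.axioms)
  note mem = rcos_mem_image_iff[OF I Pi IP]
  show "ideal ((+>) I ` P) (R Quot I)" by (rule ring_ideal_imp_quot_ideal[OF I Pi])
  show "cring (R Quot I)" by (rule ideal.quotient_is_cring[OF I is_cring])
  have "\<one> \<notin> P"
    using primeideal.I_notcarr[OF P] ideal.one_imp_carrier[OF Pi] by blast
  then have "I +> \<one> \<notin> (+>) I ` P" by (simp add: mem)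
  then show "carrier (R Quot I) \<noteq> (+>) I ` P"
    using carrier_quotient[of I] by blast
  fix A B assume "A \<in> carrier (R Quot I)" "B \<in> carrier (R Quot I)"
    and AB: "A \<otimes>\<^bsub>R Quot I\<^esub> B \<in> (+>) I ` P"
  then obtain a b where ab: "a \<in> carrier R" "b \<in> carrier R" "A = I +> a" "B = I +> b"
    unfolding carrier_quotient by blast
  with AB have "a \<otimes> b \<in> P" by (simp add: ideal.rcos_mult[OF I] mem)
  then show "A \<in> (+>) I ` P \<or> B \<in> (+>) I ` P"
    using primeideal.I_prime[OF P ab(1,2)] ab mem by blast
qed

text \<open>The other half. An ideal of the quotient is a set of cosets, so its union is its
  preimage under the projection; the zero of the quotient is the coset \<open>I\<close>
  itself.\<close>

lemma (in cring) primeideal_quotient_Union: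
  assumes I: "ideal I R" and J: "primeideal J (R Quot I)"
  shows "primeideal (\<Union>J) R" and "I \<subseteq> \<Union>J"
proof -
  have Ji: "ideal J (R Quot I)" using J by (simp add: primeideal.axioms)
  have Jc: "J \<subseteq> carrier (R Quot I)"
    using additive_subgroup.a_subset[OF ideal.axioms(1)[OF Ji]] .
  note mem = canonical_proj_vimage_mem_iff[OF I Jc]
  have "I = \<zero>\<^bsub>R Quot I\<^esub>" by (simp add: FactRing_def)
  then have "I \<in> J"
    using additive_subgroup.zero_closed[OF ideal.axioms(1)[OF Ji]] by simp
  then show "I \<subseteq> \<Union>J" by blast
  show "primeideal (\<Union>J) R"
  proof (rule primeidealI)
    show "ideal (\<Union>J) R" by (rule quot_ideal_imp_ring_ideal[OF I Ji])
    show "cring R" by (rule is_cring)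
    show "carrier R \<noteq> \<Union>J"
      using primeideal.I_notcarr[OF J] mem Jc unfolding carrier_quotient by blast
    fix a b assume ab: "a \<in> carrier R" "b \<in> carrier R" "a \<otimes> b \<in> \<Union>J"
    then have "(I +> a) \<otimes>\<^bsub>R Quot I\<^esub> (I +> b) \<in> J"
      by (simp add: ideal.rcos_mult[OF I] mem del: Union_iff)
    then show "a \<in> \<Union>J \<or> b \<in> \<Union>J"
      using primeideal.I_prime[OF J, of "I +> a" "I +> b"] ab mem
      by (auto simp: carrier_quotient simp del: Union_iff)
  qed
qed

section \<open>Chains of primes and the Krull dimension of a quotient\<close>

definition prime_chain :: "('a, 'r) ring_scheme \<Rightarrow> nat \<Rightarrow> (nat \<Rightarrow> 'a set) \<Rightarrow> bool" where
  "prime_chain A n Q \<longleftrightarrow> (\<forall>i\<le>n. primeideal (Q i) A) \<and> (\<forall>i<n. Q i \<subset> Q (Suc i))"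

lemma prime_chain_first_subset:
  assumes "prime_chain A n Q" "i \<le> n"
  shows "Q 0 \<subseteq> Q i"
  using \<open>i \<le> n\<close>
proof (induction i)
  case (Suc i)
  then have "Q i \<subset> Q (Suc i)" using assms(1) by (simp add: prime_chain_def)
  with Suc show ?case by simp
qed simp

text \<open>Images and preimages under the projection carry chains to chains of the same length.
  Coheights and module dimensions can thus be measured by chains in \<open>R\<close>.\<close>

lemma (in cring) krull_dim_quotient:
  assumes I: "ideal I R"
  shows "krull_dim (R Quot I) = Sup {enat n | n. \<exists>Q. prime_chain R n Q \<and> I \<subseteq> Q 0}"
proof -
  have "(\<exists>Q. prime_chain (R Quot I) n Q) \<longleftrightarrow> (\<exists>Q. prime_chain R n Q \<and> I \<subseteq> Q 0)" for n
  proof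
    assume "\<exists>Q. prime_chain (R Quot I) n Q"
    then obtain Q where Q: "prime_chain (R Quot I) n Q" by blast
    have pr: "primeideal (Q i) (R Quot I)" if "i \<le> n" for i
      using Q that by (simp add: prime_chain_def)
    have sub: "Q i \<subseteq> carrier (R Quot I)" if "i \<le> n" for i
      using additive_subgroup.a_subset[OF ideal.axioms(1)[OF primeideal.axioms(1)[OF pr[OF that]]]] .
    have "\<Union>(Q i) \<subset> \<Union>(Q (Suc i))" if i: "i < n" for i
    proof -
      have "Q i \<subset> Q (Suc i)" using Q that by (simp add: prime_chain_def)
      \<comment> \<open>A representative of a coset gained at this step separates the two
        preimages.\<close>
      then obtain A where A: "A \<in> Q (Suc i)" "A \<notin> Q i" by blast
      then obtain a where a: "a \<in> carrier R" "A = I +> a"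
        using sub[of "Suc i"] i carrier_quotient[of I] by (auto simp: Suc_le_eq)
      have "a \<in> \<Union>(Q (Suc i))" "a \<notin> \<Union>(Q i)"
        using canonical_proj_vimage_mem_iff[OF I sub, of _ a] A a that
        by (simp_all del: Union_iff)
      with \<open>Q i \<subset> Q (Suc i)\<close> show ?thesis by blast
    qed
    then have "prime_chain R n (\<lambda>i. \<Union>(Q i))"
      using primeideal_quotient_Union(1)[OF I] pr by (simp add: prime_chain_def)
    then show "\<exists>Q. prime_chain R n Q \<and> I \<subseteq> Q 0"
      using primeideal_quotient_Union(2)[OF I pr[of 0]] by blast
  next
    assume "\<exists>Q. prime_chain R n Q \<and> I \<subseteq> Q 0"
    then obtain Q where Q: "prime_chain R n Q" and "I \<subseteq> Q 0" by blast
    then have IQ: "I \<subseteq> Q i" if "i \<le> n" for i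
      using prime_chain_first_subset that by blast
    have pr: "primeideal (Q i) R" if "i \<le> n" for i
      using Q that by (simp add: prime_chain_def)
    have "(+>) I ` Q i \<subset> (+>) I ` Q (Suc i)" if "i < n" for i
    proof -
      have "Q i \<subset> Q (Suc i)" using Q that by (simp add: prime_chain_def)
      then obtain a where a: "a \<in> Q (Suc i)" "a \<notin> Q i" by blast
      have id: "ideal (Q i) R" "ideal (Q (Suc i)) R"
        using pr that by (simp_all add: primeideal.axioms)
      have "a \<in> carrier R" using a ideal.Icarr[OF id(2)] by blast
      then have "I +> a \<notin> (+>) I ` Q i"
        using rcos_mem_image_iff[OF I id(1) IQ] a that by simp
      with a \<open>Q i \<subset> Q (Suc i)\<close> show ?thesis by blast
    qed
    then have "prime_chain (R Quot I) n (\<lambda>i. (+>) I ` Q i)"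
      using primeideal_quotient_image[OF I] pr IQ by (simp add: prime_chain_def)
    then show "\<exists>Q. prime_chain (R Quot I) n Q" by blast
  qed
  then show ?thesis by (simp add: krull_dim_def prime_chain_def)
qed

lemma (in cring) krull_dim_quotient_mono:
  assumes "ideal I R" "ideal J R" "I \<subseteq> J"
  shows "krull_dim (R Quot J) \<le> krull_dim (R Quot I)"
  unfolding krull_dim_quotient[OF assms(1)] krull_dim_quotient[OF assms(2)]
  by (rule Sup_subset_mono) (use \<open>I \<subseteq> J\<close> in blast)


section \<open>Noetherian and local rings\<close>

text \<open>Zorn's lemma applies because in a Noetherian ring a nonempty chain of ideals contains
  its own union, which is then an upper bound inside \<open>C\<close>.\<close>

lemma (in noetherian_ring) exists_maximal_member:
  assumes "C \<noteq> {}" and "\<And>I. I \<in> C \<Longrightarrow> ideal I R"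
  shows "\<exists>I\<in>C. \<forall>J\<in>C. I \<subseteq> J \<longrightarrow> J = I"
proof (rule subset_Zorn)
  fix D assume D: "subset.chain C D"
  show "\<exists>U\<in>C. \<forall>X\<in>D. X \<subseteq> U"
  proof (cases "D = {}")
    case False
    have "subset.chain {I. ideal I R} D"
      using D assms(2) by (auto simp: pred_on.chain_def)
    then have "\<Union>D \<in> D" by (rule ideal_chain_is_trivial[OF False])
    moreover have "D \<subseteq> C" using D by (simp add: pred_on.chain_def)
    ultimately show ?thesis by blast
  qed (use assms(1) in blast)
qed

text \<open>Noetherianity supplies a maximal element among the proper ideals containing
  \<open>I\<close>; it is a maximal ideal, hence equal to \<open>M\<close> by uniqueness.\<close>

lemma (in local_ring) ideal_subset_maximal:
  assumes "noetherian_ring R" "ideal I R" "I \<noteq> carrier R"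
  shows "I \<subseteq> M"
proof -
  interpret noetherian_ring R by fact
  define C where "C = {J. ideal J R \<and> I \<subseteq> J \<and> J \<noteq> carrier R}"
  have "\<exists>J\<in>C. \<forall>K\<in>C. J \<subseteq> K \<longrightarrow> K = J"
    by (rule exists_maximal_member) (use assms in \<open>auto simp: C_def\<close>)
  then obtain J where J: "J \<in> C" and max: "\<And>K. K \<in> C \<Longrightarrow> J \<subseteq> K \<Longrightarrow> K = J"
    by blast
  have "maximalideal J R"
  proof (rule maximalidealI)
    show "ideal J R" "carrier R \<noteq> J" using J by (auto simp: C_def)
    fix K assume "ideal K R" "J \<subseteq> K"
    then show "K = J \<or> K = carrier R" using J max[of K] unfolding C_def by blast
  qed
  then have "J = M" by (rule maximal_unique)
  then show ?thesis using J by (simp add: C_def)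
qed

text \<open>If \<open>\<one> \<ominus> a\<close> lay in \<open>M\<close>, so would
  \<open>\<one>\<close>; hence its principal ideal is not inside \<open>M\<close> and must be all of
  \<open>R\<close>.\<close>

lemma (in local_ring) one_minus_invertible:
  assumes "noetherian_ring R" "a \<in> M"
  shows "\<exists>u\<in>carrier R. u \<otimes> (\<one> \<ominus> a) = \<one>"
proof -
  have a: "a \<in> carrier R" using assms(2) by (rule Icarr)
  have "\<one> \<ominus> a \<notin> M"
  proof
    assume "\<one> \<ominus> a \<in> M"
    then have "(\<one> \<ominus> a) \<oplus> a \<in> M" using assms(2) by (rule a_closed)
    moreover have "(\<one> \<ominus> a) \<oplus> a = \<one>" using a by algebra
    ultimately show False using one_imp_carrier I_notcarr by simp
  qed
  then have "PIdl (\<one> \<ominus> a) = carrier R"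
    using ideal_subset_maximal[OF assms(1) cgenideal_ideal] cgenideal_self[of "\<one> \<ominus> a"] a
    by blast
  then have "\<one> \<in> PIdl (\<one> \<ominus> a)" by simp
  then show ?thesis unfolding cgenideal_def by force
qed


section \<open>Submodules\<close>

context module
begin

lemma submodule_zero: "submodule H R M \<Longrightarrow> \<zero>\<^bsub>M\<^esub> \<in> H"
  using subgroup.one_closed[OF submodule.axioms(1)] by fastforce

lemma submodule_diff:
  assumes "submodule H R M" "x \<in> H" "y \<in> H"
  shows "x \<ominus>\<^bsub>M\<^esub> y \<in> H"
  using assms submoduleE(3,5)[OF assms(1)] by (simp add: a_minus_def)

lemma submodule_zero_set: "submodule {\<zero>\<^bsub>M\<^esub>} R M"
  by (rule submoduleI) auto

lemma submodule_set_add: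
  assumes H: "submodule H R M" and K: "submodule K R M"
  shows "submodule (H <+>\<^bsub>M\<^esub> K) R M"
proof (rule submoduleI)
  note Hc = subsetD[OF submoduleE(1)[OF H]] and Kc = subsetD[OF submoduleE(1)[OF K]]
  show "H <+>\<^bsub>M\<^esub> K \<subseteq> carrier M" using Hc Kc by (auto simp: set_add_def')
  have "\<zero>\<^bsub>M\<^esub> = \<zero>\<^bsub>M\<^esub> \<oplus>\<^bsub>M\<^esub> \<zero>\<^bsub>M\<^esub>" by simp
  then show "\<zero>\<^bsub>M\<^esub> \<in> H <+>\<^bsub>M\<^esub> K"
    using submodule_zero[OF H] submodule_zero[OF K] unfolding set_add_def' by blast
  fix a assume "a \<in> H <+>\<^bsub>M\<^esub> K"
  then obtain h k where hk: "h \<in> H" "k \<in> K" "a = h \<oplus>\<^bsub>M\<^esub> k" by (auto simp: set_add_def')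
  then have "\<ominus>\<^bsub>M\<^esub> a = \<ominus>\<^bsub>M\<^esub> h \<oplus>\<^bsub>M\<^esub> \<ominus>\<^bsub>M\<^esub> k" using Hc Kc by (simp add: M.minus_add)
  then show "\<ominus>\<^bsub>M\<^esub> a \<in> H <+>\<^bsub>M\<^esub> K"
    using submoduleE(3)[OF H hk(1)] submoduleE(3)[OF K hk(2)] unfolding set_add_def' by blast
  { fix r assume r: "r \<in> carrier R"
    then have "r \<odot>\<^bsub>M\<^esub> a = r \<odot>\<^bsub>M\<^esub> h \<oplus>\<^bsub>M\<^esub> r \<odot>\<^bsub>M\<^esub> k" using hk Hc Kc by (simp add: smult_r_distr)
    then show "r \<odot>\<^bsub>M\<^esub> a \<in> H <+>\<^bsub>M\<^esub> K"
      using submoduleE(4)[OF H r hk(1)] submoduleE(4)[OF K r hk(2)] unfolding set_add_def' by blast }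
  fix b assume "b \<in> H <+>\<^bsub>M\<^esub> K"
  then obtain h' k' where hk': "h' \<in> H" "k' \<in> K" "b = h' \<oplus>\<^bsub>M\<^esub> k'" by (auto simp: set_add_def')
  then have "a \<oplus>\<^bsub>M\<^esub> b = (h \<oplus>\<^bsub>M\<^esub> h') \<oplus>\<^bsub>M\<^esub> (k \<oplus>\<^bsub>M\<^esub> k')"
    using hk Hc Kc by (simp add: M.a_ac)
  then show "a \<oplus>\<^bsub>M\<^esub> b \<in> H <+>\<^bsub>M\<^esub> K"
    using submoduleE(5)[OF H hk(1) hk'(1)] submoduleE(5)[OF K hk(2) hk'(2)]
    unfolding set_add_def' by blast
qed

lemma set_add_upper:
  assumes "submodule H R M" "submodule K R M"
  shows "H \<subseteq> H <+>\<^bsub>M\<^esub> K" and "K \<subseteq> H <+>\<^bsub>M\<^esub> K"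
proof -
  note Hc = subsetD[OF submoduleE(1)[OF assms(1)]] and Kc = subsetD[OF submoduleE(1)[OF assms(2)]]
  show "H \<subseteq> H <+>\<^bsub>M\<^esub> K"
  proof
    fix h assume "h \<in> H"
    then have "h = h \<oplus>\<^bsub>M\<^esub> \<zero>\<^bsub>M\<^esub>" using Hc by simp
    then show "h \<in> H <+>\<^bsub>M\<^esub> K"
      using \<open>h \<in> H\<close> submodule_zero[OF assms(2)] unfolding set_add_def' by blast
  qed
  show "K \<subseteq> H <+>\<^bsub>M\<^esub> K"
  proof
    fix k assume "k \<in> K"
    then have "k = \<zero>\<^bsub>M\<^esub> \<oplus>\<^bsub>M\<^esub> k" using Kc by simp
    then show "k \<in> H <+>\<^bsub>M\<^esub> K"
      using \<open>k \<in> K\<close> submodule_zero[OF assms(1)] unfolding set_add_def' by blast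
  qed
qed

lemma submodule_cyclic:
  assumes x: "x \<in> carrier M"
  shows "submodule ((\<lambda>a. a \<odot>\<^bsub>M\<^esub> x) ` carrier R) R M"
proof (rule submoduleI)
  show "\<zero>\<^bsub>M\<^esub> \<in> (\<lambda>a. a \<odot>\<^bsub>M\<^esub> x) ` carrier R"
    using x by (intro image_eqI[of _ _ "\<zero>"]) auto
next
  fix u assume "u \<in> (\<lambda>a. a \<odot>\<^bsub>M\<^esub> x) ` carrier R"
  then obtain a where a: "a \<in> carrier R" "u = a \<odot>\<^bsub>M\<^esub> x" by blast
  then show "\<ominus>\<^bsub>M\<^esub> u \<in> (\<lambda>a. a \<odot>\<^bsub>M\<^esub> x) ` carrier R"
    using x by (intro image_eqI[of _ _ "\<ominus> a"]) (auto simp: smult_l_minus)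
  { fix v assume "v \<in> (\<lambda>a. a \<odot>\<^bsub>M\<^esub> x) ` carrier R"
    then obtain b where "b \<in> carrier R" "v = b \<odot>\<^bsub>M\<^esub> x" by blast
    then show "u \<oplus>\<^bsub>M\<^esub> v \<in> (\<lambda>a. a \<odot>\<^bsub>M\<^esub> x) ` carrier R"
      using a x by (intro image_eqI[of _ _ "a \<oplus> b"]) (auto simp: smult_l_distr) }
  fix r assume "r \<in> carrier R"
  then show "r \<odot>\<^bsub>M\<^esub> u \<in> (\<lambda>a. a \<odot>\<^bsub>M\<^esub> x) ` carrier R"
    using a x by (intro image_eqI[of _ _ "r \<otimes> a"]) (auto simp: smult_assoc1)
qed (use x in auto)

lemma submodule_smult_image:
  assumes a: "a \<in> carrier R"
  shows "submodule ((\<lambda>y. a \<odot>\<^bsub>M\<^esub> y) ` carrier M) R M"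
proof (rule submoduleI)
  show "\<zero>\<^bsub>M\<^esub> \<in> (\<lambda>y. a \<odot>\<^bsub>M\<^esub> y) ` carrier M"
    using a by (intro image_eqI[of _ _ "\<zero>\<^bsub>M\<^esub>"]) auto
next
  fix u assume "u \<in> (\<lambda>y. a \<odot>\<^bsub>M\<^esub> y) ` carrier M"
  then obtain y where y: "y \<in> carrier M" "u = a \<odot>\<^bsub>M\<^esub> y" by blast
  then show "\<ominus>\<^bsub>M\<^esub> u \<in> (\<lambda>y. a \<odot>\<^bsub>M\<^esub> y) ` carrier M"
    using a by (intro image_eqI[of _ _ "\<ominus>\<^bsub>M\<^esub> y"]) (auto simp: smult_r_minus)
  { fix v assume "v \<in> (\<lambda>y. a \<odot>\<^bsub>M\<^esub> y) ` carrier M"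
    then obtain z where "z \<in> carrier M" "v = a \<odot>\<^bsub>M\<^esub> z" by blast
    then show "u \<oplus>\<^bsub>M\<^esub> v \<in> (\<lambda>y. a \<odot>\<^bsub>M\<^esub> y) ` carrier M"
      using a y by (intro image_eqI[of _ _ "y \<oplus>\<^bsub>M\<^esub> z"]) (auto simp: smult_r_distr) }
  fix r assume r: "r \<in> carrier R"
  then have "r \<odot>\<^bsub>M\<^esub> u = a \<odot>\<^bsub>M\<^esub> (r \<odot>\<^bsub>M\<^esub> y)"
    using a y by (simp add: smult_assoc1[symmetric] R.m_comm)
  then show "r \<odot>\<^bsub>M\<^esub> u \<in> (\<lambda>y. a \<odot>\<^bsub>M\<^esub> y) ` carrier M"
    using r y by blast
qed (use a in auto)

lemma submodule_smult_vimage: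
  assumes H: "submodule H R M" and a: "a \<in> carrier R"
  shows "submodule {y \<in> carrier M. a \<odot>\<^bsub>M\<^esub> y \<in> H} R M"
proof (rule submoduleI)
  fix r y assume r: "r \<in> carrier R" and y: "y \<in> {y \<in> carrier M. a \<odot>\<^bsub>M\<^esub> y \<in> H}"
  then have "a \<odot>\<^bsub>M\<^esub> (r \<odot>\<^bsub>M\<^esub> y) = r \<odot>\<^bsub>M\<^esub> (a \<odot>\<^bsub>M\<^esub> y)"
    using a by (simp add: smult_assoc1[symmetric] R.m_comm)
  then show "r \<odot>\<^bsub>M\<^esub> y \<in> {y \<in> carrier M. a \<odot>\<^bsub>M\<^esub> y \<in> H}"
    using r y submoduleE(4)[OF H] by simp
qed (use a submoduleE(3,5)[OF H] submodule_zero[OF H] in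
      \<open>auto simp: smult_r_minus smult_r_distr\<close>)

section \<open>Generated submodules and the submodules (X)M\<close>

lemma submodule_generated:
  assumes "S \<subseteq> carrier M"
  shows "submodule (generated_submodule R M S) R M"
proof (rule submoduleI)
  show "generated_submodule R M S \<subseteq> carrier M"
    using carrier_is_submodule assms by (auto simp: generated_submodule_def)
qed (auto simp: generated_submodule_def submodule_zero submoduleE)

lemma generated_submodule_minimal:
  "submodule H R M \<Longrightarrow> S \<subseteq> H \<Longrightarrow> generated_submodule R M S \<subseteq> H"
  by (auto simp: generated_submodule_def)

lemma generated_submodule_superset: "S \<subseteq> generated_submodule R M S"
  by (auto simp: generated_submodule_def)

lemma generated_submodule_empty: "generated_submodule R M {} = {\<zero>\<^bsub>M\<^esub>}"
  using generated_submodule_minimal[OF submodule_zero_set]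
    submodule_zero[OF submodule_generated[of "{}"]] by auto

text \<open>The right-hand side is a submodule containing \<open>s\<close> and \<open>S\<close>.
  This splits off one generator for the induction over a finite generating set.\<close>

lemma generated_submodule_insert:
  assumes "s \<in> carrier M" "S \<subseteq> carrier M"
  shows "generated_submodule R M (insert s S)
    \<subseteq> (\<lambda>a. a \<odot>\<^bsub>M\<^esub> s) ` carrier R <+>\<^bsub>M\<^esub> generated_submodule R M S"
proof (rule generated_submodule_minimal)
  note cs = submodule_cyclic[OF assms(1)] and gs = submodule_generated[OF assms(2)]
  show "submodule ((\<lambda>a. a \<odot>\<^bsub>M\<^esub> s) ` carrier R <+>\<^bsub>M\<^esub> generated_submodule R M S) R M"
    by (rule submodule_set_add[OF cs gs])
  have "s \<in> (\<lambda>a. a \<odot>\<^bsub>M\<^esub> s) ` carrier R"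
    using assms by (intro image_eqI[of _ _ \<one>]) auto
  then show "insert s S \<subseteq> (\<lambda>a. a \<odot>\<^bsub>M\<^esub> s) ` carrier R <+>\<^bsub>M\<^esub> generated_submodule R M S"
    using set_add_upper[OF cs gs] generated_submodule_superset by blast
qed

lemma scalar_submodule_generators:
  assumes "X \<subseteq> carrier R"
  shows "{a \<odot>\<^bsub>M\<^esub> y | a y. a \<in> X \<and> y \<in> carrier M} \<subseteq> carrier M"
  using assms by auto

lemma submodule_scalar:
  "X \<subseteq> carrier R \<Longrightarrow> submodule (scalar_submodule R M X) R M"
  unfolding scalar_submodule_def by (intro submodule_generated scalar_submodule_generators)

lemma scalar_submodule_empty: "scalar_submodule R M {} = {\<zero>\<^bsub>M\<^esub>}"
  by (simp add: scalar_submodule_def generated_submodule_empty)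

lemma smult_mem_scalar_submodule:
  "a \<in> X \<Longrightarrow> y \<in> carrier M \<Longrightarrow> a \<odot>\<^bsub>M\<^esub> y \<in> scalar_submodule R M X"
  unfolding scalar_submodule_def by (rule subsetD[OF generated_submodule_superset]) blast

text \<open>Adjoining one scalar turns \<open>K = (X)M\<close> into \<open>K + xM\<close>, the form
  in which a step along a regular sequence is handled.\<close>

lemma scalar_submodule_insert:
  assumes x: "x \<in> carrier R" and X: "X \<subseteq> carrier R"
  shows "scalar_submodule R M (insert x X)
    = scalar_submodule R M X <+>\<^bsub>M\<^esub> (\<lambda>y. x \<odot>\<^bsub>M\<^esub> y) ` carrier M"
proof
  note ss = submodule_scalar[OF X] and xs = submodule_smult_image[OF x]
  have "{a \<odot>\<^bsub>M\<^esub> y | a y. a \<in> insert x X \<and> y \<in> carrier M}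
      \<subseteq> scalar_submodule R M X \<union> (\<lambda>y. x \<odot>\<^bsub>M\<^esub> y) ` carrier M"
    using smult_mem_scalar_submodule by auto
  then have "{a \<odot>\<^bsub>M\<^esub> y | a y. a \<in> insert x X \<and> y \<in> carrier M}
      \<subseteq> scalar_submodule R M X <+>\<^bsub>M\<^esub> (\<lambda>y. x \<odot>\<^bsub>M\<^esub> y) ` carrier M"
    using set_add_upper[OF ss xs] by blast
  then show "scalar_submodule R M (insert x X)
      \<subseteq> scalar_submodule R M X <+>\<^bsub>M\<^esub> (\<lambda>y. x \<odot>\<^bsub>M\<^esub> y) ` carrier M"
    unfolding scalar_submodule_def[of R M "insert x X"]
    by (rule generated_submodule_minimal[OF submodule_set_add[OF ss xs]])
  have sub: "submodule (scalar_submodule R M (insert x X)) R M"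
    using x X by (intro submodule_scalar) auto
  have "scalar_submodule R M X \<subseteq> scalar_submodule R M (insert x X)"
    unfolding scalar_submodule_def[of R M X]
    by (rule generated_submodule_minimal[OF sub]) (auto intro: smult_mem_scalar_submodule)
  then show "scalar_submodule R M X <+>\<^bsub>M\<^esub> (\<lambda>y. x \<odot>\<^bsub>M\<^esub> y) ` carrier M
      \<subseteq> scalar_submodule R M (insert x X)"
    using submoduleE(5)[OF sub] smult_mem_scalar_submodule[of x "insert x X"]
    by (auto simp: set_add_def')
qed

end


section \<open>The maximal condition for finitely generated modules\<close>

definition colon_ideal ::
    "('a, 'r) ring_scheme \<Rightarrow> ('a, 'b, 'm) module_scheme \<Rightarrow> 'b set \<Rightarrow> 'b \<Rightarrow> 'a set" where
  "colon_ideal R N K x = {a \<in> carrier R. a \<odot>\<^bsub>N\<^esub> x \<in> K}"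

lemma element_annihilator_colon: "element_annihilator R N x = colon_ideal R N {\<zero>\<^bsub>N\<^esub>} x"
  by (simp add: element_annihilator_def colon_ideal_def)

context module
begin

lemma ideal_colon:
  assumes K: "submodule K R M" and x: "x \<in> carrier M"
  shows "ideal (colon_ideal R M K x) R"
proof (rule idealI)
  show "subgroup (colon_ideal R M K x) (add_monoid R)"
    by (rule R.add.subgroupI)
      (use x submodule_zero[OF K] submoduleE(3,5)[OF K] in
        \<open>auto simp: colon_ideal_def smult_l_distr smult_l_minus
          simp flip: a_inv_def intro!: exI[of _ "\<zero>"]\<close>)
  fix a r assume a: "a \<in> colon_ideal R M K x" and r: "r \<in> carrier R"
  then show "r \<otimes> a \<in> colon_ideal R M K x"
    using x submoduleE(4)[OF K r] by (auto simp: colon_ideal_def smult_assoc1)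
  then show "a \<otimes> r \<in> colon_ideal R M K x"
    using a r by (simp add: R.m_comm colon_ideal_def)
qed (rule R.ring_axioms)

lemma ideal_module_annihilator: "ideal (module_annihilator R M) R"
proof -
  have "module_annihilator R M = \<Inter>((\<lambda>x. colon_ideal R M {\<zero>\<^bsub>M\<^esub>} x) ` carrier M)"
    using M.zero_closed by (auto simp: module_annihilator_def colon_ideal_def)
  then show ?thesis
    using R.i_Intersect[of "(\<lambda>x. colon_ideal R M {\<zero>\<^bsub>M\<^esub>} x) ` carrier M"]
      ideal_colon[OF submodule_zero_set] M.zero_closed by auto
qed

text \<open>Maximality is relativized to the span of \<open>S\<close> so that induction over
  \<open>S\<close> works. For a new generator \<open>s\<close>, a submodule \<open>H\<close> is
  controlled by the ideal \<open>(H + G : s)\<close>, where \<open>G\<close> is the span of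
  \<open>S\<close>, and by its trace on \<open>G\<close>. The ideal is made maximal first, by
  Noetherianity of \<open>R\<close>, and then the trace, by the induction hypothesis.\<close>

lemma exists_maximal_on_generated:
  assumes "noetherian_ring R" and "finite S" "S \<subseteq> carrier M"
    and "C \<noteq> {}" "\<And>H. H \<in> C \<Longrightarrow> submodule H R M"
  shows "\<exists>H\<in>C. \<forall>H'\<in>C. H \<subseteq> H' \<longrightarrow> H' \<inter> generated_submodule R M S \<subseteq> H"
  using assms(2-)
proof (induction S arbitrary: C)
  case empty
  then obtain H where H: "H \<in> C" by blast
  with empty have "\<zero>\<^bsub>M\<^esub> \<in> H" using submodule_zero by blast
  then show ?case using H by (auto simp: generated_submodule_empty)
next
  case (insert s S)
  let ?G = "generated_submodule R M S"
  have s: "s \<in> carrier M" and S: "S \<subseteq> carrier M" using insert.prems by auto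
  have G: "submodule ?G R M" by (rule submodule_generated[OF S])
  define I where "I H = colon_ideal R M (H <+>\<^bsub>M\<^esub> ?G) s" for H
  have "ideal (I H) R" if "H \<in> C" for H
    unfolding I_def
    by (rule ideal_colon[OF submodule_set_add[OF insert.prems(3)[OF that] G] s])
  then have "\<exists>K\<in>I ` C. \<forall>J\<in>I ` C. K \<subseteq> J \<longrightarrow> J = K"
    using insert.prems(2) by (intro noetherian_ring.exists_maximal_member[OF assms(1)]) auto
  then obtain H0 where H0: "H0 \<in> C" "\<And>H. H \<in> C \<Longrightarrow> I H0 \<subseteq> I H \<Longrightarrow> I H = I H0"
    by blast
  define C' where "C' = {H \<in> C. I H = I H0}"
  have "\<exists>H\<in>C'. \<forall>H'\<in>C'. H \<subseteq> H' \<longrightarrow> H' \<inter> ?G \<subseteq> H"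
    by (rule insert.IH[OF S]) (use insert.prems(3) H0(1) in \<open>auto simp: C'_def\<close>)
  then obtain H where H: "H \<in> C'"
    and max: "\<forall>H'\<in>C'. H \<subseteq> H' \<longrightarrow> H' \<inter> ?G \<subseteq> H"
    by (rule bexE)
  have "H' \<inter> generated_submodule R M (insert s S) \<subseteq> H" if H': "H' \<in> C" "H \<subseteq> H'" for H'
  proof
    have sub: "submodule H R M" "submodule H' R M" using H H' insert.prems by (auto simp: C'_def)
    note cc = subsetD[OF submoduleE(1)[OF sub(1)]] subsetD[OF submoduleE(1)[OF sub(2)]]
      subsetD[OF submoduleE(1)[OF G]]
    \<comment> \<open>A larger submodule has a larger ideal, so maximality forces equality and
      \<open>H'\<close> belongs to \<open>C'\<close>.\<close>
    have "I H \<subseteq> I H'" using H'(2) by (auto simp: I_def colon_ideal_def set_add_def')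
    then have "I H' = I H0" using H H'(1) H0(2)[of H'] by (simp add: C'_def)
    then have HG: "H' \<inter> ?G \<subseteq> H" using max H' H by (simp add: C'_def)
    fix h assume "h \<in> H' \<inter> generated_submodule R M (insert s S)"
    then obtain a t where h: "h \<in> H'" and a: "a \<in> carrier R" and t: "t \<in> ?G"
      and hat: "h = a \<odot>\<^bsub>M\<^esub> s \<oplus>\<^bsub>M\<^esub> t"
      using generated_submodule_insert[OF s S] by (auto simp: set_add_def')
    have as: "a \<odot>\<^bsub>M\<^esub> s = h \<oplus>\<^bsub>M\<^esub> \<ominus>\<^bsub>M\<^esub> t"
      using a s cc(3)[OF t] by (simp add: hat M.a_assoc M.r_neg)
    then have "a \<in> I H'"
      using a h submoduleE(3)[OF G t] by (auto simp: I_def colon_ideal_def set_add_def')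
    then have "a \<in> I H" using \<open>I H' = I H0\<close> H by (simp add: C'_def)
    \<comment> \<open>As \<open>a\<close> also lies in the ideal of the smaller \<open>H\<close>,
      its multiple of \<open>s\<close> has a summand \<open>h0\<close> from \<open>H\<close>.
      Subtracting \<open>h0\<close> from \<open>h\<close> leaves an element of \<open>H'\<close> in
      \<open>G\<close>, to which the trace condition applies.\<close>
    then obtain h0 t0 where h0: "h0 \<in> H" and t0: "t0 \<in> ?G" and eq: "a \<odot>\<^bsub>M\<^esub> s = h0 \<oplus>\<^bsub>M\<^esub> t0"
      by (auto simp: I_def colon_ideal_def set_add_def')
    have "h \<ominus>\<^bsub>M\<^esub> h0 = t0 \<oplus>\<^bsub>M\<^esub> t"
    proof -
      have "h = h0 \<oplus>\<^bsub>M\<^esub> (t0 \<oplus>\<^bsub>M\<^esub> t)" using hat eq cc h0 t0 t by (simp add: M.a_assoc)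
      then show ?thesis using cc h0 t0 t
        by (simp add: M.minus_eq M.a_comm[of h0] M.a_assoc M.r_neg)
    qed
    moreover have "h \<ominus>\<^bsub>M\<^esub> h0 \<in> H'" using submodule_diff[OF sub(2) h] h0 H'(2) by blast
    ultimately have "h \<ominus>\<^bsub>M\<^esub> h0 \<in> H" using HG submoduleE(5)[OF G t0 t] by auto
    then have "(h \<ominus>\<^bsub>M\<^esub> h0) \<oplus>\<^bsub>M\<^esub> h0 \<in> H" using submoduleE(5)[OF sub(1)] h0 by blast
    then show "h \<in> H" using cc h h0 by (simp add: M.minus_eq M.a_assoc M.l_neg)
  qed
  then show ?case using H by (auto simp: C'_def)
qed

text \<open>On the span of a finite generating set the trace of a submodule is the submodule itself,
  so a finitely generated module over a Noetherian ring is Noetherian.\<close>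

lemma exists_maximal_submodule:
  assumes "noetherian_ring R" and "finitely_generated_module R M"
    and "C \<noteq> {}" "\<And>H. H \<in> C \<Longrightarrow> submodule H R M"
  shows "\<exists>H\<in>C. \<forall>H'\<in>C. H \<subseteq> H' \<longrightarrow> H' \<subseteq> H"
proof -
  obtain S where S: "finite S" "S \<subseteq> carrier M" "generated_submodule R M S = carrier M"
    using assms(2) by (auto simp: finitely_generated_module_def)
  have "H \<inter> carrier M = H" if "H \<in> C" for H
    using submoduleE(1)[OF assms(4)[OF that]] by blast
  moreover have "\<exists>H\<in>C. \<forall>H'\<in>C. H \<subseteq> H' \<longrightarrow> H' \<inter> carrier M \<subseteq> H"
    using exists_maximal_on_generated[OF assms(1) S(1,2) assms(3)] assms(4) unfolding S(3) .
  ultimately show ?thesis by simp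
qed


section \<open>Associated primes\<close>

text \<open>An annihilator maximal among those contained in \<open>Q\<close> is prime; localizing at \<open>Q\<close> is
  replaced by multiplying with some \<open>c \<notin> Q\<close>.\<close>

lemma exists_prime_colon:
  assumes "noetherian_ring R" and K: "submodule K R M" and Q: "primeideal Q R"
    and x: "x \<in> carrier M" and xQ: "colon_ideal R M K x \<subseteq> Q"
  shows "\<exists>y\<in>carrier M. primeideal (colon_ideal R M K y) R \<and>
    colon_ideal R M K x \<subseteq> colon_ideal R M K y \<and> colon_ideal R M K y \<subseteq> Q"
proof -
  let ?c = "colon_ideal R M K"
  define C where "C = {y \<in> carrier M. ?c x \<subseteq> ?c y \<and> ?c y \<subseteq> Q}"
  have "\<exists>I\<in>?c ` C. \<forall>J\<in>?c ` C. I \<subseteq> J \<longrightarrow> J = I"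
    by (rule noetherian_ring.exists_maximal_member[OF assms(1)])
      (use x xQ ideal_colon[OF K] in \<open>auto simp: C_def\<close>)
  then obtain y where yC: "y \<in> C" and "\<forall>z\<in>C. ?c y \<subseteq> ?c z \<longrightarrow> ?c z = ?c y"
    by auto
  then have max: "?c z = ?c y" if "z \<in> carrier M" "?c y \<subseteq> ?c z" "?c z \<subseteq> Q" for z
    using that by (auto simp: C_def)
  have y: "y \<in> carrier M" "?c x \<subseteq> ?c y" "?c y \<subseteq> Q" using yC by (auto simp: C_def)
  \<comment> \<open>Multiplying \<open>y\<close> by a scalar can only enlarge the colon ideal; by
    maximality it stays the same unless it leaves \<open>Q\<close>.\<close>
  have mono: "?c y \<subseteq> ?c (a \<odot>\<^bsub>M\<^esub> y)" if "a \<in> carrier R" for a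
    using that y(1) submoduleE(4)[OF K]
    by (auto simp: colon_ideal_def smult_assoc1[symmetric] R.m_comm[of _ a])
       (simp add: smult_assoc1)
  have "primeideal (?c y) R"
  proof (rule primeidealI)
    show "ideal (?c y) R" by (rule ideal_colon[OF K y(1)])
    show "cring R" by (rule R.is_cring)
    show "carrier R \<noteq> ?c y"
      using y(3) primeideal.I_notcarr[OF Q] colon_ideal_def[of R M K y]
        additive_subgroup.a_subset[OF ideal.axioms(1)[OF primeideal.axioms(1)[OF Q]]] by blast
    fix a b assume a: "a \<in> carrier R" and b: "b \<in> carrier R" and ab: "a \<otimes> b \<in> ?c y"
    have "a \<in> ?c y" if "b \<notin> ?c y"
    proof -
      have "b \<in> ?c (a \<odot>\<^bsub>M\<^esub> y)"
        using a b ab y(1) by (simp add: colon_ideal_def smult_assoc1[symmetric] R.m_comm)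
      \<comment> \<open>The colon ideal of \<open>ay\<close> contains \<open>b\<close>, so it is
        strictly larger than that of \<open>y\<close> and must leave \<open>Q\<close>;
        \<open>c\<close> is a witness.\<close>
      then have "\<not> ?c (a \<odot>\<^bsub>M\<^esub> y) \<subseteq> Q" using max[of "a \<odot>\<^bsub>M\<^esub> y"] mono a y(1) that by auto
      then obtain c where c: "c \<in> carrier R" "c \<odot>\<^bsub>M\<^esub> (a \<odot>\<^bsub>M\<^esub> y) \<in> K" "c \<notin> Q"
        by (auto simp: colon_ideal_def)
      \<comment> \<open>If \<open>d\<close> sends \<open>cy\<close> into \<open>K\<close>, then
        \<open>dc\<close> lies in \<open>Q\<close>, and \<open>c\<close> does not, so
        \<open>d\<close> does. Hence \<open>cy\<close> has the same colon ideal as \<open>y\<close>,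
        and \<open>a\<close> lies in it.\<close>
      have "?c (c \<odot>\<^bsub>M\<^esub> y) \<subseteq> Q"
      proof
        fix d assume "d \<in> ?c (c \<odot>\<^bsub>M\<^esub> y)"
        then have "d \<in> carrier R" "d \<otimes> c \<in> ?c y"
          using c(1) y(1) by (auto simp: colon_ideal_def smult_assoc1)
        then show "d \<in> Q" using primeideal.I_prime[OF Q _ c(1)] y(3) c(3) by blast
      qed
      then have "?c (c \<odot>\<^bsub>M\<^esub> y) = ?c y" using max mono c(1) y(1) by simp
      moreover have "a \<in> ?c (c \<odot>\<^bsub>M\<^esub> y)"
        using a c y(1) by (simp add: colon_ideal_def smult_assoc1[symmetric] R.m_comm)
      ultimately show ?thesis by simp
    qed
    then show "a \<in> ?c y \<or> b \<in> ?c y" by blast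
  qed
  with y show ?thesis by blast
qed

text \<open>Each \<open>s\<close> is annihilated by some scalar outside \<open>Q\<close>; the
  product of these finitely many scalars annihilates all of \<open>S\<close> and stays outside
  \<open>Q\<close> by primality.\<close>

lemma exists_outside_prime_annihilating:
  assumes Q: "primeideal Q R" and "finite S" "S \<subseteq> carrier M"
    and "\<And>s. s \<in> S \<Longrightarrow> \<not> element_annihilator R M s \<subseteq> Q"
  shows "\<exists>c\<in>carrier R - Q. \<forall>s\<in>S. c \<odot>\<^bsub>M\<^esub> s = \<zero>\<^bsub>M\<^esub>"
  using assms(2-)
proof (induction S)
  case empty
  have "\<one> \<notin> Q"
    using primeideal.I_notcarr[OF Q] ideal.one_imp_carrier[OF primeideal.axioms(1)[OF Q]] by blast
  then show ?case by blast
next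
  case (insert s S)
  then obtain c where c: "c \<in> carrier R - Q" "\<And>t. t \<in> S \<Longrightarrow> c \<odot>\<^bsub>M\<^esub> t = \<zero>\<^bsub>M\<^esub>" by auto
  obtain d where d: "d \<in> carrier R - Q" "d \<odot>\<^bsub>M\<^esub> s = \<zero>\<^bsub>M\<^esub>"
    using insert.prems(2)[of s] by (auto simp: element_annihilator_def)
  have "d \<otimes> c \<in> carrier R - Q" using c d primeideal.I_prime[OF Q, of d c] by blast
  moreover have "(d \<otimes> c) \<odot>\<^bsub>M\<^esub> t = \<zero>\<^bsub>M\<^esub>" if "t \<in> insert s S" for t
  proof (cases "t = s")
    case True
    then have "(d \<otimes> c) \<odot>\<^bsub>M\<^esub> t = (c \<otimes> d) \<odot>\<^bsub>M\<^esub> s" using c d by (simp add: R.m_comm)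
    also have "\<dots> = c \<odot>\<^bsub>M\<^esub> (d \<odot>\<^bsub>M\<^esub> s)" using c d insert.prems by (simp add: smult_assoc1)
    finally show ?thesis using c d by simp
  next
    case False
    then have "t \<in> S" "t \<in> carrier M" using that insert.prems by auto
    then show ?thesis using c d by (simp add: smult_assoc1)
  qed
  ultimately show ?case by blast
qed

text \<open>Were every generator annihilated by some scalar outside \<open>Q\<close>, a single such
  scalar would annihilate the whole module. So some generator has its annihilator inside
  \<open>Q\<close>, and this enlarges to a prime annihilator inside \<open>Q\<close>.\<close>

lemma exists_associated_prime_below:
  assumes "noetherian_ring R" "finitely_generated_module R M"
    and Q: "primeideal Q R" and AQ: "module_annihilator R M \<subseteq> Q"
  shows "\<exists>P\<in>associated_primes R M. P \<subseteq> Q"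
proof -
  obtain S where S: "finite S" "S \<subseteq> carrier M" "generated_submodule R M S = carrier M"
    using assms(2) by (auto simp: finitely_generated_module_def)
  have "\<exists>s\<in>S. element_annihilator R M s \<subseteq> Q"
  proof (rule ccontr)
    assume "\<not> ?thesis"
    then obtain c where c: "c \<in> carrier R" "c \<notin> Q" "\<And>s. s \<in> S \<Longrightarrow> c \<odot>\<^bsub>M\<^esub> s = \<zero>\<^bsub>M\<^esub>"
      using exists_outside_prime_annihilating[OF Q S(1,2)] by blast
    \<comment> \<open>The elements killed by \<open>c\<close> form a submodule, so it is enough that
      \<open>c\<close> kills the generators.\<close>
    have "carrier M \<subseteq> {y \<in> carrier M. c \<odot>\<^bsub>M\<^esub> y \<in> {\<zero>\<^bsub>M\<^esub>}}"
      unfolding S(3)[symmetric]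
      by (rule generated_submodule_minimal)
        (use submodule_smult_vimage[OF submodule_zero_set c(1)] S c in auto)
    then have "c \<in> module_annihilator R M" using c by (auto simp: module_annihilator_def)
    then show False using AQ c by blast
  qed
  then obtain s where "s \<in> carrier M" "colon_ideal R M {\<zero>\<^bsub>M\<^esub>} s \<subseteq> Q"
    using S(2) by (auto simp: element_annihilator_colon)
  from exists_prime_colon[OF assms(1) submodule_zero_set Q this] show ?thesis
    unfolding associated_primes_def element_annihilator_colon by blast
qed

section \<open>Dimension as the supremum of the coheights of associated primes\<close>

lemma coheight_le_module_dim:
  assumes "P \<in> associated_primes R M"
  shows "coheight R P \<le> module_dim R M"
  unfolding coheight_def module_dim_def
proof (rule R.krull_dim_quotient_mono[OF ideal_module_annihilator])
  show "ideal P R" using assms by (simp add: associated_primes_def primeideal.axioms)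
  show "module_annihilator R M \<subseteq> P"
    using assms by (auto simp: associated_primes_def module_annihilator_def element_annihilator_def)
qed

text \<open>A chain of primes above the annihilator also lies above an associated prime contained in
  its first member, so its length is bounded by that coheight. For the zero module both sides are
  suprema of the empty set, which is \<open>0\<close> in \<open>enat\<close>.\<close>

lemma module_dim_eq_Sup_coheight:
  assumes "noetherian_ring R" "finitely_generated_module R M"
  shows "module_dim R M = Sup (coheight R ` associated_primes R M)"
proof (rule antisym)
  show "Sup (coheight R ` associated_primes R M) \<le> module_dim R M"
    using coheight_le_module_dim by (auto intro: Sup_least)
  show "module_dim R M \<le> Sup (coheight R ` associated_primes R M)"
    unfolding module_dim_def R.krull_dim_quotient[OF ideal_module_annihilator]
  proof (rule Sup_least, clarify)
    fix n Q assume Q: "prime_chain R n Q" "module_annihilator R M \<subseteq> Q 0"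
    then have "primeideal (Q 0) R" by (simp add: prime_chain_def)
    then obtain P where P: "P \<in> associated_primes R M" "P \<subseteq> Q 0"
      using exists_associated_prime_below[OF assms] Q(2) by blast
    then have "ideal P R" by (simp add: associated_primes_def primeideal.axioms)
    then have "enat n \<le> coheight R P"
      unfolding coheight_def R.krull_dim_quotient[OF \<open>ideal P R\<close>]
      using P Q by (auto intro: Sup_upper)
    also have "\<dots> \<le> Sup (coheight R ` associated_primes R M)" using P by (auto intro: Sup_upper)
    finally show "enat n \<le> Sup (coheight R ` associated_primes R M)" .
  qed
qed


section \<open>Regular sequences and depth\<close>

text \<open>Nakayama's lemma for \<open>H/K\<close>, with \<open>H\<close> a mere subset: if \<open>K + Rh\<close> is maximal
  with \<open>h \<in> H - K\<close> and \<open>h \<equiv> x h'\<close> modulo \<open>K\<close>, then \<open>K + Rh' = K + Rh\<close>, so \<open>h' \<equiv> r x h'\<close> for some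
  \<open>r\<close>, and \<open>1 - r x\<close> is a unit.\<close>

lemma nakayama_relative:
  assumes "noetherian_ring R" "finitely_generated_module R M" "local_ring J R" and x: "x \<in> J"
    and K: "submodule K R M" and H: "H \<subseteq> carrier M"
    and step: "\<And>h. h \<in> H \<Longrightarrow> \<exists>k\<in>K. \<exists>h'\<in>H. h = k \<oplus>\<^bsub>M\<^esub> x \<odot>\<^bsub>M\<^esub> h'"
  shows "H \<subseteq> K"
proof (rule ccontr)
  assume "\<not> H \<subseteq> K"
  define L where "L h = K <+>\<^bsub>M\<^esub> (\<lambda>a. a \<odot>\<^bsub>M\<^esub> h) ` carrier R" for h
  \<comment> \<open>In the \<open>module\<close> locale \<open>M\<close> is the module, so the
    maximal ideal is called \<open>J\<close>.\<close>
  have J: "ideal J R" using assms(3) by (simp add: local_ring_def maximalideal.axioms)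
  have xR: "x \<in> carrier R" using x ideal.Icarr[OF J] by blast
  note Kc = subsetD[OF submoduleE(1)[OF K]]
  have L: "submodule (L h) R M" "K \<subseteq> L h" "h \<in> L h" if "h \<in> carrier M" for h
  proof -
    note hs = submodule_cyclic[OF that]
    show "submodule (L h) R M" unfolding L_def by (rule submodule_set_add[OF K hs])
    show "K \<subseteq> L h" unfolding L_def by (rule set_add_upper[OF K hs])
    have "h \<in> (\<lambda>a. a \<odot>\<^bsub>M\<^esub> h) ` carrier R" using that by (intro image_eqI[of _ _ \<one>]) auto
    then show "h \<in> L h" unfolding L_def using set_add_upper[OF K hs] by blast
  qed
  have "\<exists>G\<in>L ` (H - K). \<forall>G'\<in>L ` (H - K). G \<subseteq> G' \<longrightarrow> G' \<subseteq> G"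
    by (rule exists_maximal_submodule[OF assms(1,2)]) (use \<open>\<not> H \<subseteq> K\<close> H L in auto)
  then obtain h where h: "h \<in> H" "h \<notin> K"
    and max: "\<forall>h'\<in>H - K. L h \<subseteq> L h' \<longrightarrow> L h' \<subseteq> L h" by auto
  obtain k h' where k: "k \<in> K" and h': "h' \<in> H" and eq: "h = k \<oplus>\<^bsub>M\<^esub> x \<odot>\<^bsub>M\<^esub> h'"
    using step[OF h(1)] by blast
  have c: "h \<in> carrier M" "h' \<in> carrier M" using h h' H by auto
  \<comment> \<open>Otherwise \<open>h\<close> would lie in \<open>K\<close>; thus \<open>h'\<close>
    competes with \<open>h\<close> in the maximal choice.\<close>
  have "h' \<notin> K" using eq h(2) k submoduleE(4)[OF K xR] submoduleE(5)[OF K k] by blast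
  have "L h \<subseteq> L h'"
  proof -
    have "h \<in> L h'"
      using eq k L(2)[OF c(2)] submoduleE(4)[OF L(1)[OF c(2)] xR L(3)[OF c(2)]]
        submoduleE(5)[OF L(1)[OF c(2)]] by blast
    then show ?thesis
      using L(2)[OF c(2)] submoduleE(4,5)[OF L(1)[OF c(2)]]
      unfolding L_def[of h] by (auto simp: set_add_def')
  qed
  then have "L h' \<subseteq> L h" using max h' \<open>h' \<notin> K\<close> by simp
  then have "h' \<in> L h" using L(3)[OF c(2)] by blast
  then obtain k' r where k': "k' \<in> K" and r: "r \<in> carrier R" and eq': "h' = k' \<oplus>\<^bsub>M\<^esub> r \<odot>\<^bsub>M\<^esub> h"
    by (auto simp: L_def set_add_def')
  have "r \<otimes> x \<in> J" using ideal.I_l_closed[OF J x r] .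
  then obtain u where u: "u \<in> carrier R" "u \<otimes> (\<one> \<ominus> r \<otimes> x) = \<one>"
    using local_ring.one_minus_invertible[OF assms(3,1)] by blast
  have "h' = (k' \<oplus>\<^bsub>M\<^esub> r \<odot>\<^bsub>M\<^esub> k) \<oplus>\<^bsub>M\<^esub> (r \<otimes> x) \<odot>\<^bsub>M\<^esub> h'"
    by (subst eq', subst eq) (use r k k' xR c Kc in \<open>simp add: smult_r_distr smult_assoc1 M.a_assoc\<close>)
  then have "h' \<ominus>\<^bsub>M\<^esub> (r \<otimes> x) \<odot>\<^bsub>M\<^esub> h' = k' \<oplus>\<^bsub>M\<^esub> r \<odot>\<^bsub>M\<^esub> k"
    using M.add.inv_solve_right'[of "k' \<oplus>\<^bsub>M\<^esub> r \<odot>\<^bsub>M\<^esub> k" h' "(r \<otimes> x) \<odot>\<^bsub>M\<^esub> h'"]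
      r k k' xR c Kc by (simp add: M.minus_eq)
  moreover have "(\<one> \<ominus> r \<otimes> x) \<odot>\<^bsub>M\<^esub> h' = h' \<ominus>\<^bsub>M\<^esub> (r \<otimes> x) \<odot>\<^bsub>M\<^esub> h'"
    using r xR c by (simp add: R.minus_eq M.minus_eq smult_l_distr smult_l_minus)
  ultimately have "(\<one> \<ominus> r \<otimes> x) \<odot>\<^bsub>M\<^esub> h' \<in> K"
    using k k' submoduleE(4)[OF K r] submoduleE(5)[OF K] by simp
  then have "u \<odot>\<^bsub>M\<^esub> ((\<one> \<ominus> r \<otimes> x) \<odot>\<^bsub>M\<^esub> h') \<in> K" using submoduleE(4)[OF K u(1)] by blast
  then have "h' \<in> K" using u c r xR by (simp add: smult_assoc1[symmetric])
  with \<open>h' \<notin> K\<close> show False by blast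
qed

text \<open>\<open>H = {h. P h \<subseteq> K}\<close> satisfies \<open>H \<inter> (K + xM) = K + xH\<close>, so by Nakayama it is not contained in
  \<open>K + xM\<close>; any \<open>w \<in> H - (K + xM)\<close> has \<open>P + xR \<subseteq> (K + xM : w)\<close>.\<close>

lemma prime_colon_step:
  assumes "noetherian_ring R" "finitely_generated_module R M" "local_ring J R" and x: "x \<in> J"
    and K: "submodule K R M" and z: "z \<in> carrier M" and P: "primeideal (colon_ideal R M K z) R"
    and reg: "\<And>y. y \<in> carrier M \<Longrightarrow> x \<odot>\<^bsub>M\<^esub> y \<in> K \<Longrightarrow> y \<in> K"
  shows "\<exists>w\<in>carrier M. primeideal (colon_ideal R M (K <+>\<^bsub>M\<^esub> (\<lambda>y. x \<odot>\<^bsub>M\<^esub> y) ` carrier M) w) R \<and>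
    colon_ideal R M K z \<subset> colon_ideal R M (K <+>\<^bsub>M\<^esub> (\<lambda>y. x \<odot>\<^bsub>M\<^esub> y) ` carrier M) w"
proof -
  interpret J: local_ring J R by fact
  let ?P = "colon_ideal R M K z"
  let ?K = "K <+>\<^bsub>M\<^esub> (\<lambda>y. x \<odot>\<^bsub>M\<^esub> y) ` carrier M"
  define H where "H = {h \<in> carrier M. \<forall>p\<in>?P. p \<odot>\<^bsub>M\<^esub> h \<in> K}"
  have xR: "x \<in> carrier R" using x by (rule J.Icarr)
  have Pc: "?P \<subseteq> carrier R" by (auto simp: colon_ideal_def)
  note xs = submodule_smult_image[OF xR]
  have K': "submodule ?K R M" by (rule submodule_set_add[OF K xs])
  note Kc = subsetD[OF submoduleE(1)[OF K]]
  \<comment> \<open>The element \<open>z\<close> witnesses that \<open>H\<close> is not inside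
    \<open>K\<close>: if \<open>z\<close> were in \<open>K\<close>, its prime colon ideal would be
    all of \<open>R\<close>.\<close>
  have "z \<in> H" using z by (auto simp: H_def colon_ideal_def)
  have "z \<notin> K"
    using primeideal.I_notcarr[OF P] submoduleE(4)[OF K] by (auto simp: colon_ideal_def)
  have "\<not> H \<subseteq> ?K"
  proof
    assume HK: "H \<subseteq> ?K"
    have "\<exists>k\<in>K. \<exists>h'\<in>H. h = k \<oplus>\<^bsub>M\<^esub> x \<odot>\<^bsub>M\<^esub> h'" if h: "h \<in> H" for h
    proof -
      obtain k y where k: "k \<in> K" and y: "y \<in> carrier M" and eq: "h = k \<oplus>\<^bsub>M\<^esub> x \<odot>\<^bsub>M\<^esub> y"
        using h HK by (auto simp: set_add_def')
      have "p \<odot>\<^bsub>M\<^esub> y \<in> K" if p: "p \<in> ?P" for p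
      proof -
        have pR: "p \<in> carrier R" using p Pc by blast
        \<comment> \<open>Since \<open>p\<close> sends both \<open>h\<close> and \<open>k\<close>
          into \<open>K\<close>, it follows that \<open>x(py)\<close> is in \<open>K\<close>;
          regularity of \<open>x\<close> modulo \<open>K\<close> then gives \<open>py\<close> in
          \<open>K\<close>. So \<open>y\<close> itself serves as the \<open>h'\<close> of Nakayama's
          lemma.\<close>
        have "p \<odot>\<^bsub>M\<^esub> h \<ominus>\<^bsub>M\<^esub> p \<odot>\<^bsub>M\<^esub> k = x \<odot>\<^bsub>M\<^esub> (p \<odot>\<^bsub>M\<^esub> y)"
          using pR k y xR Kc
          by (simp add: eq smult_r_distr smult_assoc1[symmetric] R.m_comm[of x p] M.minus_eq
              M.a_comm[of "p \<odot>\<^bsub>M\<^esub> k"] M.a_assoc M.r_neg)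
        moreover have "p \<odot>\<^bsub>M\<^esub> h \<in> K" using h p by (simp add: H_def)
        ultimately have "x \<odot>\<^bsub>M\<^esub> (p \<odot>\<^bsub>M\<^esub> y) \<in> K"
          using submodule_diff[OF K] submoduleE(4)[OF K pR k] by metis
        then show ?thesis using reg pR y by simp
      qed
      then have "y \<in> H" using y by (simp add: H_def)
      with k eq show ?thesis by blast
    qed
    moreover have "H \<subseteq> carrier M" by (auto simp: H_def)
    ultimately have "H \<subseteq> K" by (intro nakayama_relative[OF assms(1-3) x K])
    then show False using \<open>z \<in> H\<close> \<open>z \<notin> K\<close> by blast
  qed
  then obtain w where w: "w \<in> H" "w \<notin> ?K" by blast
  have wc: "w \<in> carrier M" using w by (simp add: H_def)
  have wi: "ideal (colon_ideal R M ?K w) R" by (rule ideal_colon[OF K' wc])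
  have "colon_ideal R M ?K w \<noteq> carrier R"
  proof
    assume "colon_ideal R M ?K w = carrier R"
    then have "\<one> \<in> colon_ideal R M ?K w" by simp
    then show False using w(2) wc by (simp add: colon_ideal_def)
  qed
  then have "colon_ideal R M ?K w \<subseteq> J" by (rule J.ideal_subset_maximal[OF assms(1) wi])
  \<comment> \<open>The maximal ideal serves as the prime under which the colon ideal of
    \<open>w\<close> is enlarged to a prime one.\<close>
  then obtain v where v: "v \<in> carrier M" "primeideal (colon_ideal R M ?K v) R"
    "colon_ideal R M ?K w \<subseteq> colon_ideal R M ?K v"
    using exists_prime_colon[OF assms(1) K' R.maximalideal_prime[OF J.is_maximalideal] wc] by blast
  have "?P \<subseteq> colon_ideal R M ?K w"
    using w(1) Pc set_add_upper(1)[OF K xs] by (auto simp: H_def colon_ideal_def)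
  moreover have "x \<in> colon_ideal R M ?K w"
    using xR wc set_add_upper(2)[OF K xs] by (auto simp: colon_ideal_def)
  \<comment> \<open>Strictness comes from \<open>x\<close>: were \<open>xz\<close> in
    \<open>K\<close>, regularity would put \<open>z\<close> in \<open>K\<close>.\<close>
  moreover have "x \<notin> ?P" using reg[OF z] \<open>z \<notin> K\<close> by (auto simp: colon_ideal_def)
  ultimately show ?thesis using v by blast
qed

text \<open>The last member of the chain is kept as a colon ideal, that is, as a prime associated to
  the quotient by the first \<open>n\<close> entries; this is what lets
  \<open>prime_colon_step\<close> extend the chain. A prefix of length \<open>n\<close> gives
  \<open>n\<close> strict inclusions between \<open>n + 1\<close> primes.\<close>

lemma regular_sequence_prime_chain:
  assumes "noetherian_ring R" "finitely_generated_module R M" "local_ring J R"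
    and reg: "regular_sequence R M xs" and xsJ: "set xs \<subseteq> J"
    and P: "P \<in> associated_primes R M" and "n \<le> length xs"
  shows "\<exists>Q. prime_chain R n Q \<and> Q 0 = P \<and>
    (\<exists>z\<in>carrier M. Q n = colon_ideal R M (scalar_submodule R M (set (take n xs))) z)"
  using \<open>n \<le> length xs\<close>
proof (induction n)
  case 0
  \<comment> \<open>The empty prefix generates the zero submodule, so colon ideals are element
    annihilators here.\<close>
  then show ?case
    using P by (intro exI[of _ "\<lambda>_. P"])
      (auto simp: prime_chain_def associated_primes_def element_annihilator_colon
        scalar_submodule_empty)
next
  case (Suc n)
  let ?K = "scalar_submodule R M (set (take n xs))"
  have xs: "set xs \<subseteq> carrier R" using reg by (simp add: regular_sequence_def)
  obtain Q z where Q: "prime_chain R n Q" "Q 0 = P" and z: "z \<in> carrier M"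
    and Qn: "Q n = colon_ideal R M ?K z"
    using Suc by auto
  have n: "n < length xs" using Suc.prems by simp
  have X: "set (take n xs) \<subseteq> carrier R" using xs set_take_subset[of n xs] by blast
  have x: "xs ! n \<in> J" "xs ! n \<in> carrier R" using n xs xsJ nth_mem by blast+
  have K': "scalar_submodule R M (set (take (Suc n) xs))
      = ?K <+>\<^bsub>M\<^esub> (\<lambda>y. xs ! n \<odot>\<^bsub>M\<^esub> y) ` carrier M"
    using scalar_submodule_insert[OF x(2) X] n by (simp add: take_Suc_conv_app_nth)
  obtain w where w: "w \<in> carrier M"
    "primeideal (colon_ideal R M (scalar_submodule R M (set (take (Suc n) xs))) w) R"
    "Q n \<subset> colon_ideal R M (scalar_submodule R M (set (take (Suc n) xs))) w"
    using prime_colon_step[OF assms(1-3) x(1) submodule_scalar[OF X] z] Q(1) n reg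
    unfolding K' Qn[symmetric] by (auto simp: prime_chain_def regular_sequence_def)
  let ?Q = "Q(Suc n := colon_ideal R M (scalar_submodule R M (set (take (Suc n) xs))) w)"
  have "prime_chain R (Suc n) ?Q"
    using Q(1) w by (auto simp: prime_chain_def le_Suc_eq less_Suc_eq)
  moreover have "?Q 0 = P" using Q(2) by simp
  moreover have "?Q (Suc n) = colon_ideal R M (scalar_submodule R M (set (take (Suc n) xs))) w"
    by simp
  ultimately show ?case using w(1) by blast
qed

text \<open>The chain obtained from a regular sequence in \<open>J\<close> starts at
  \<open>P\<close> itself, so \<open>coheight\<close> counts it.\<close>

lemma depth_le_coheight:
  assumes "noetherian_ring R" "finitely_generated_module R M" "local_ring J R"
    and P: "P \<in> associated_primes R M"
  shows "depth R J M \<le> coheight R P"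
proof -
  have "ideal P R" using P by (simp add: associated_primes_def primeideal.axioms)
  have "enat (length xs) \<le> coheight R P"
    if "regular_sequence R M xs" "set xs \<subseteq> J" for xs
    using regular_sequence_prime_chain[OF assms(1-3) that P order_refl]
    unfolding coheight_def R.krull_dim_quotient[OF \<open>ideal P R\<close>]
    by (auto intro!: Sup_upper)
  then show ?thesis unfolding depth_def by (auto intro!: Sup_least)
qed

text \<open>A nonzero element has a proper annihilator, which lies in \<open>J\<close> and so
  enlarges to a prime annihilator.\<close>

lemma exists_associated_prime:
  assumes "noetherian_ring R" "local_ring J R" "carrier M \<noteq> {\<zero>\<^bsub>M\<^esub>}"
  shows "associated_primes R M \<noteq> {}"
proof -
  interpret J: local_ring J R by fact
  obtain x where x: "x \<in> carrier M" "x \<noteq> \<zero>\<^bsub>M\<^esub>" using assms(3) M.zero_closed by blast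
  have "\<one> \<notin> colon_ideal R M {\<zero>\<^bsub>M\<^esub>} x" using x by (simp add: colon_ideal_def)
  then have "colon_ideal R M {\<zero>\<^bsub>M\<^esub>} x \<noteq> carrier R" by auto
  then have "colon_ideal R M {\<zero>\<^bsub>M\<^esub>} x \<subseteq> J"
    by (rule J.ideal_subset_maximal[OF assms(1) ideal_colon[OF submodule_zero_set x(1)]])
  from exists_prime_colon[OF assms(1) submodule_zero_set
      R.maximalideal_prime[OF J.is_maximalideal] x(1) this]
  show ?thesis unfolding associated_primes_def element_annihilator_colon by blast
qed

end

section \<open>Comparison of depth, initial dimension and dimension\<close>

theorem theorem1p2:
  fixes R :: "('a, 'r) ring_scheme" and M :: "'a set" and N :: "('a, 'b, 'm) module_scheme"
  assumes "noetherian_ring R"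
    and "local_ring M R"
    and "module R N"
    and "finitely_generated_module R N"
  shows "cohen_macaulay R M N \<longleftrightarrow> initially_cohen_macaulay R M N \<and> counmixed R N"
proof -
  interpret module R N by fact
  let ?A = "associated_primes R N"
  show ?thesis
  proof (cases "carrier N = {\<zero>\<^bsub>N\<^esub>}")
    case True
    \<comment> \<open>The zero module has no associated primes, so counmixedness is vacuous; the
      other two notions hold by convention.\<close>
    have "?A = {}"
    proof -
      have "element_annihilator R N x = carrier R" if "x \<in> carrier N" for x
        using that True by (auto simp: element_annihilator_def)
      then show ?thesis using primeideal.I_notcarr by (fastforce simp: associated_primes_def)
    qed
    then show ?thesis
      using True by (simp add: cohen_macaulay_def initially_cohen_macaulay_def counmixed_def)
  next
    case False
    obtain P where P: "P \<in> ?A" using exists_associated_prime[OF assms(1,2) False] by blast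
    note depth_le = depth_le_coheight[OF assms(1,4,2)]
    have CM: "cohen_macaulay R M N \<longleftrightarrow> depth R M N = module_dim R N"
      and ICM: "initially_cohen_macaulay R M N \<longleftrightarrow> depth R M N = indim R N"
      using False by (auto simp: cohen_macaulay_def initially_cohen_macaulay_def)
    show ?thesis
    proof
      assume "cohen_macaulay R M N"
      \<comment> \<open>Each coheight is squeezed between the depth and the dimension, which agree
        here.\<close>
      then have "coheight R Q = depth R M N" if "Q \<in> ?A" for Q
        using depth_le[OF that] coheight_le_module_dim[OF that] CM by simp
      \<comment> \<open>The existence of \<open>P\<close> matters: over an empty set the infimum
        would be \<open>\<infinity>\<close>.\<close>
      then show "initially_cohen_macaulay R M N \<and> counmixed R N"
        using P by (auto simp: ICM indim_def counmixed_def image_constant_conv)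
    next
      assume *: "initially_cohen_macaulay R M N \<and> counmixed R N"
      then have "coheight R Q = coheight R P" if "Q \<in> ?A" for Q
        using P that unfolding counmixed_def by blast
      \<comment> \<open>A single common value is both the infimum, which is \<open>indim\<close>,
        and the supremum, which is \<open>module_dim\<close>.\<close>
      then have "coheight R ` ?A = {coheight R P}" using P by blast
      then show "cohen_macaulay R M N"
        using * module_dim_eq_Sup_coheight[OF assms(1,4)] by (simp add: CM ICM indim_def)
    qed
  qed
qed

end
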